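(* Let $A\in\mathbb{C}^{n\times n}$ be a matrix having all its eigenvalues in the open right half-plane. Given any Hermitian positive definite $C\in\mathbb{C}^{n\times n}$, let $G\in\mathbb{C}^{n\times n}$ denote the solution of the Lyapunov equation $A^*G+GA=C$. Let $b\in\mathbb{C}^n$ be nonzero. Then, at the $k$th iteration, the residual $r_k$ produced by GMRES applied to $Ax=b$ with starting vector $x_0=0$ satisfies $$\frac{\|r_k\|_2}{\|b\|_2}\;\le\;\sqrt{\kappa_2(G)}\;\left(1-\frac{\mu_G(A)^2}{\|A\|_G^2}\right)^{k/2},$$ where $\kappa_2(G):=\|G\|_2\,\|G^{-1}\|_2$.
   Context: $\|\cdot\|_2$ is the Euclidean vector norm and its induced matrix norm; $A^*$ is the conjugate transpose. Since all eigenvalues of $A$ lie in the open right half-plane and $C$ is Hermitian positive definite, the equation $A^*G+GA=C$ has a unique solution $G$, and it is Hermitian positive definite (standard fact). The $G$-inner product is $\langle v,w\rangle_G:=w^*Gv$, with vector norm $\|v\|_G:=\sqrt{\langle v,v\rangle_G}$ and induced matrix norm $\|X\|_G:=\max_{v\ne 0}\|Xv\|_G/\|v\|_G$ for $X\in\mathbb{C}^{n\times n}$. The numerical range of $A$ in the $G$-inner product is $$W_G(A):=\left\{\frac{\langle Av,v\rangle_G}{\langle v,v\rangle_G}:0\neq v\in\mathbb{C}^n\right\}=\left\{\frac{v^*GAv}{v^*Gv}:0\ne v\in\mathbb{C}^n\right\},$$ and $\mu_G(A):=\min_{z\in W_G(A)}\mathrm{Re}(z)$. Equivalently, if $G=R^*R$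 is a Cholesky (or square root) factorization, $\mu_G(A)=\lambda_{\min}\big(\tfrac12(RAR^{-1}+R^{-*}A^*R^* )\big)$ and $\|A\|_G=\|RAR^{-1}\|_2$. GMRES (in the standard Euclidean norm, with $x_0=0$): at iteration $k$ it produces $x_k$ minimizing $\|b-Ax\|_2$ over all $x$ in the Krylov subspace $\mathcal{K}_k(A,b)=\mathrm{span}\{b,Ab,\ldots,A^{k-1}b\}$, and the residual is $r_k:=b-Ax_k$. *)

theory Defs
  imports "HOL-Analysis.Analysis"
begin

definition conj_transpose :: "complex ^ 'm ^ 'n \<Rightarrow> complex ^ 'n ^ 'm"
  where "conj_transpose A = map_matrix cnj (transpose A)"

definition eigenvalue :: "complex ^ 'n ^ 'n \<Rightarrow> complex \<Rightarrow> bool"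
  where "eigenvalue A z \<longleftrightarrow> (\<exists>v. v \<noteq> 0 \<and> A *v v = z *s v)"

(* ginner G v w = w^* G v: linear in the first argument, as in the convention <v, w>_G *)
definition ginner :: "complex ^ 'n ^ 'n \<Rightarrow> complex ^ 'n \<Rightarrow> complex ^ 'n \<Rightarrow> complex"
  where "ginner G v w = (\<Sum>i\<in>UNIV. cnj (w $ i) * (G *v v) $ i)"

(* for Hermitian C the number v^* C v is real, so Re loses nothing *)
definition hermitian_posdef :: "complex ^ 'n ^ 'n \<Rightarrow> bool"
  where "hermitian_posdef C \<longleftrightarrow>
    conj_transpose C = C \<and> (\<forall>v. v \<noteq> 0 \<longrightarrow> Re (ginner C v v) > 0)"

definition gnorm :: "complex ^ 'n ^ 'n \<Rightarrow> complex ^ 'n \<Rightarrow> real"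
  where "gnorm G v = sqrt (Re (ginner G v v))"

(* For Hermitian positive definite G the supremum here and the infimum in mu are attained,
   see matrix_gnorm_attained and mu_attained below. *)
definition matrix_gnorm :: "complex ^ 'n ^ 'n \<Rightarrow> complex ^ 'n ^ 'n \<Rightarrow> real"
  where "matrix_gnorm G X = (SUP v\<in>-{0}. gnorm G (X *v v) / gnorm G v)"

definition numerical_range :: "complex ^ 'n ^ 'n \<Rightarrow> complex ^ 'n ^ 'n \<Rightarrow> complex set"
  where "numerical_range G A = {ginner G (A *v v) v / ginner G v v | v. v \<noteq> 0}"

definition mu :: "complex ^ 'n ^ 'n \<Rightarrow> complex ^ 'n ^ 'n \<Rightarrow> real"
  where "mu G A = Inf (Re ` numerical_range G A)"

(* norm on complex ^ 'n is the Euclidean norm *)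
definition matrix_norm2 :: "complex ^ 'n ^ 'n \<Rightarrow> real"
  where "matrix_norm2 X = onorm ((*v) X)"

definition cond2 :: "complex ^ 'n ^ 'n \<Rightarrow> real"
  where "cond2 G = matrix_norm2 G * matrix_norm2 (matrix_inv G)"

(* vec.span is the span over the complex scalars (span would be the real one) *)
definition krylov :: "complex ^ 'n ^ 'n \<Rightarrow> complex ^ 'n \<Rightarrow> nat \<Rightarrow> (complex ^ 'n) set"
  where "krylov A b k = vec.span ((\<lambda>j. (((*v) A) ^^ j) b) ` {..<k})"

(* starting vector 0, so the affine search space is the Krylov space itself *)
definition gmres_iterate :: "complex ^ 'n ^ 'n \<Rightarrow> complex ^ 'n \<Rightarrow> nat \<Rightarrow> complex ^ 'n \<Rightarrow> bool"
  where "gmres_iterate A b k x \<longleftrightarrow>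
    is_arg_min (\<lambda>y. norm (b - A *v y)) (\<lambda>y. y \<in> krylov A b k) x"

lemma homogeneous_attains_inf:
  fixes f :: "complex ^ 'n \<Rightarrow> real"
  assumes cont: "continuous_on (-{0}) f"
    and hom: "\<And>c v. c > 0 \<Longrightarrow> v \<noteq> 0 \<Longrightarrow> f (c *\<^sub>R v) = f v"
  shows "\<exists>v. v \<noteq> 0 \<and> (\<forall>w. w \<noteq> 0 \<longrightarrow> f v \<le> f w)"
proof -
  have "continuous_on (sphere 0 1) f"
    using cont by (rule continuous_on_subset) auto
  moreover have "(axis undefined 1 :: complex ^ 'n) \<in> sphere 0 1"
    by simp
  then have "sphere (0 :: complex ^ 'n) 1 \<noteq> {}"
    by blast
  ultimately obtain v where v: "v \<in> sphere 0 1" "\<forall>w\<in>sphere 0 1. f v \<le> f w"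
    using continuous_attains_inf[OF compact_sphere] by blast
  have "f v \<le> f w" if "w \<noteq> 0" for w
  proof -
    have "f v \<le> f ((1 / norm w) *\<^sub>R w)"
      using v(2) that by simp
    also have "\<dots> = f w"
      using that by (intro hom) auto
    finally show ?thesis .
  qed
  with v(1) show ?thesis
    by (intro exI[of _ v]) auto
qed

lemma matrix_vector_mult_scaleR_complex:
  "(A :: complex ^ 'n ^ 'm) *v (c *\<^sub>R v) = c *\<^sub>R (A *v v)"
  by (simp add: vec_eq_iff matrix_vector_mult_def scaleR_sum_right)

lemma ginner_scaleR: "ginner G (c *\<^sub>R v) (c *\<^sub>R w) = c\<^sup>2 *\<^sub>R ginner G v w"
  by (simp add: ginner_def matrix_vector_mult_scaleR_complex scaleR_sum_right power2_eq_square)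

lemma continuous_on_ginner [continuous_intros]:
  assumes "continuous_on S f" "continuous_on S g"
  shows "continuous_on S (\<lambda>x. ginner G (f x) (g x))"
  unfolding ginner_def matrix_vector_mult_def
  using assms by (auto intro!: continuous_intros)

lemma continuous_on_matrix_mult_complex:
  "continuous_on S ((*v) (A :: complex ^ 'n ^ 'm))"
  unfolding matrix_vector_mult_def by (auto intro!: continuous_intros)

lemma mu_attained:
  assumes "hermitian_posdef G"
  shows "mu G A \<in> Re ` numerical_range G A" and "z \<in> numerical_range G A \<Longrightarrow> mu G A \<le> Re z"
proof -
  let ?f = "\<lambda>v. Re (ginner G (A *v v) v / ginner G v v)"
  have nz: "ginner G v v \<noteq> 0" if "v \<noteq> 0" for v
    using assms that by (force simp: hermitian_posdef_def)
  have "continuous_on (-{0}) ?f"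
    by (auto intro!: continuous_intros continuous_on_matrix_mult_complex nz)
  moreover have "?f (c *\<^sub>R v) = ?f v" if "c > 0" for c v
    using that
    by (simp add: matrix_vector_mult_scaleR_complex ginner_scaleR
        scaleR_conv_of_real[where 'a = complex])
  ultimately obtain v where v: "v \<noteq> 0" "\<forall>w. w \<noteq> 0 \<longrightarrow> ?f v \<le> ?f w"
    using homogeneous_attains_inf[of ?f] by blast
  have "mu G A = ?f v"
    unfolding mu_def using v by (intro cInf_eq_minimum) (auto simp: numerical_range_def)
  with v show "mu G A \<in> Re ` numerical_range G A"
    and "z \<in> numerical_range G A \<Longrightarrow> mu G A \<le> Re z"
    by (auto simp: numerical_range_def)
qed

lemma matrix_gnorm_attained:
  assumes "hermitian_posdef G"
  shows "\<exists>v. v \<noteq> 0 \<and> matrix_gnorm G X = gnorm G (X *v v) / gnorm G v"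
    and "w \<noteq> 0 \<Longrightarrow> gnorm G (X *v w) / gnorm G w \<le> matrix_gnorm G X"
proof -
  let ?f = "\<lambda>v. gnorm G (X *v v) / gnorm G v"
  have nz: "gnorm G v \<noteq> 0" if "v \<noteq> 0" for v
    using assms that by (force simp: hermitian_posdef_def gnorm_def)
  have "continuous_on (-{0}) (\<lambda>v. - ?f v)"
    using nz unfolding gnorm_def
    by (auto intro!: continuous_intros continuous_on_matrix_mult_complex)
  moreover have "- ?f (c *\<^sub>R v) = - ?f v" if "c > 0" for c v
    using that
    by (simp add: gnorm_def matrix_vector_mult_scaleR_complex ginner_scaleR real_sqrt_mult)
  ultimately obtain v where v: "v \<noteq> 0" "\<forall>w. w \<noteq> 0 \<longrightarrow> - ?f v \<le> - ?f w"
    using homogeneous_attains_inf[of "\<lambda>v. - ?f v"] by blast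
  have "matrix_gnorm G X = ?f v"
    unfolding matrix_gnorm_def using v by (intro cSup_eq_maximum) auto
  with v show "\<exists>v. v \<noteq> 0 \<and> matrix_gnorm G X = gnorm G (X *v v) / gnorm G v"
    and "w \<noteq> 0 \<Longrightarrow> gnorm G (X *v w) / gnorm G w \<le> matrix_gnorm G X"
    by auto
qed

end

theory Submission
  imports Defs "HOL-Computational_Algebra.Fundamental_Theorem_Algebra"
begin

text \<open>
  GMRES minimises the residual over the Krylov space, so it suffices to exhibit one element of that
  space whose residual is small. The damped Richardson iteration \<open>y \<mapsto> y + \<alpha> (b - A y)\<close>, started at
  \<open>0\<close>, stays in the Krylov spaces and multiplies the residual by \<open>I - \<alpha> A\<close> in each step
  (\<open>damped_residual_in_krylov\<close>). In the \<open>G\<close>-norm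
  \<open>\<parallel>v - \<alpha> A v\<parallel>\<^sup>2 = \<parallel>v\<parallel>\<^sup>2 - 2 \<alpha> Re \<langle>A v, v\<rangle> + \<alpha>\<^sup>2 \<parallel>A v\<parallel>\<^sup>2 \<le> (1 - 2 \<alpha> \<mu> + \<alpha>\<^sup>2 \<parallel>A\<parallel>\<^sup>2) \<parallel>v\<parallel>\<^sup>2\<close>, and the
  minimiser \<open>\<alpha> = \<mu> / \<parallel>A\<parallel>\<^sup>2\<close> of the right-hand side gives the contraction factor
  (\<open>damped_step_contraction\<close>). Passing from the Euclidean norm to the \<open>G\<close>-norm and back costs
  \<open>\<parallel>G\<^sup>-\<^sup>1\<parallel>\<close> and \<open>\<parallel>G\<parallel>\<close> under square roots (\<open>norm_le_ginner\<close>, \<open>ginner_le_norm\<close>), whence the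
  condition number.

  All of this needs \<open>G\<close> to be Hermitian positive definite, which is Lyapunov's theorem
  (\<open>lyapunov_solution_posdef\<close>). It is proved algebraically, without the integral formula for the
  solution. Suppose a Hermitian form \<open>h\<close> is positive definite on an invariant subspace \<open>V\<close> of \<open>A\<close>. If
  \<open>V\<close> is proper, there is a \<open>u\<close> outside \<open>V\<close>, \<open>h\<close>-orthogonal to \<open>V\<close>, with \<open>A u \<in> z u + V\<close> for some
  eigenvalue \<open>z\<close> of \<open>A\<close>. Then \<open>Re h(A u, u) = Re z h(u, u)\<close>; as the left-hand side and \<open>Re z\<close> are
  positive, so is \<open>h(u, u)\<close>, and \<open>h\<close> is positive definite on the larger space spanned by \<open>V\<close> and \<open>u\<close>.
\<close>

section \<open>Sesquilinear forms of matrices\<close>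

lemma ginner_add_left: "ginner G (u + v) w = ginner G u w + ginner G v w"
  by (simp add: ginner_def matrix_vector_right_distrib ring_distribs sum.distrib)

lemma ginner_add_right: "ginner G u (v + w) = ginner G u v + ginner G u w"
  by (simp add: ginner_def ring_distribs sum.distrib)

lemma ginner_scale_left: "ginner G (c *s v) w = c * ginner G v w"
  by (simp add: ginner_def vec.scale sum_distrib_left mult_ac)

lemma ginner_scale_right: "ginner G v (c *s w) = cnj c * ginner G v w"
  by (simp add: ginner_def sum_distrib_left mult_ac)

lemma ginner_adjoint: "ginner (conj_transpose A ** G) v w = ginner G v (A *v w)"
proof -
  have entry: "(conj_transpose A *v x) $ i = (\<Sum>j\<in>UNIV. cnj (A $ j $ i) * x $ j)" for x i
    by (simp add: matrix_vector_mult_def conj_transpose_def map_matrix_def transpose_def)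
  have "ginner (conj_transpose A ** G) v w
      = (\<Sum>i\<in>UNIV. \<Sum>j\<in>UNIV. cnj (w $ i) * (cnj (A $ j $ i) * (G *v v) $ j))"
    unfolding ginner_def matrix_vector_mul_assoc[symmetric]
    by (simp add: entry sum_distrib_left)
  also have "\<dots> = (\<Sum>j\<in>UNIV. \<Sum>i\<in>UNIV. cnj (w $ i) * (cnj (A $ j $ i) * (G *v v) $ j))"
    by (rule sum.swap)
  also have "\<dots> = ginner G v (A *v w)"
    by (simp add: ginner_def matrix_vector_mult_def[of A] sum_distrib_left sum_distrib_right mult_ac)
  finally show ?thesis .
qed

lemma ginner_mult: "ginner (G ** A) v w = ginner G (A *v v) w"
  by (simp add: ginner_def matrix_vector_mul_assoc)

lemma ginner_matrix_add: "ginner (G + H) v w = ginner G v w + ginner H v w"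
  by (simp add: ginner_def matrix_vector_mult_add_rdistrib ring_distribs sum.distrib)

lemma ginner_axis: "ginner G (axis j 1) (axis i 1) = G $ i $ j"
proof -
  have col: "G *v axis j 1 = column j G"
    by (simp add: vec_eq_iff matrix_vector_mult_def column_def axis_def if_distrib cong: if_cong)
  have "ginner G (axis j 1) (axis i 1) = (\<Sum>l\<in>UNIV. if l = i then G $ l $ j else 0)"
    unfolding ginner_def col by (intro sum.cong) (auto simp: axis_def column_def)
  then show ?thesis by simp
qed

lemma ginner_hermitian:
  assumes "conj_transpose G = G"
  shows "ginner G v w = cnj (ginner G w v)"
proof -
  have "ginner G v w = ginner (mat 1) v (G *v w)"
    using ginner_adjoint[of G "mat 1" v w] assms by simp
  also have "\<dots> = cnj (ginner G w v)"
    by (simp add: ginner_def mult_ac)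
  finally show ?thesis .
qed

lemma ginner_self_real:
  assumes "hermitian_posdef G"
  shows "ginner G v v = of_real (Re (ginner G v v))"
  using ginner_hermitian[of G v v] assms by (simp add: hermitian_posdef_def complex_eq_iff)

text \<open>Polarisation: comparing the form on \<open>v + w\<close> and on \<open>v + \<i> w\<close> yields the imaginary and the real part
  of the symmetry \<open>\<langle>v, w\<rangle> = \<langle>w, v\<rangle>\<^sup>*\<close>.\<close>

lemma hermitian_if_real_quadratic_form:
  assumes "\<And>v. Im (ginner G v v) = 0"
  shows "conj_transpose G = G"
proof -
  have "ginner G v w = cnj (ginner G w v)" for v w
  proof -
    have "Im (ginner G v w) + Im (ginner G w v) = 0"
      using assms[of "v + w"] assms[of v] assms[of w] by (simp add: ginner_add_left ginner_add_right)
    moreover have "Re (ginner G v w) - Re (ginner G w v) = 0"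
      using assms[of "v + \<i> *s w"] assms[of v] assms[of w]
      by (simp add: ginner_add_left ginner_add_right ginner_scale_left ginner_scale_right)
    ultimately show ?thesis
      by (simp add: complex_eq_iff)
  qed
  then have "cnj (G $ j $ i) = G $ i $ j" for i j
    unfolding ginner_axis[symmetric] by metis
  then show ?thesis
    by (simp add: vec_eq_iff conj_transpose_def map_matrix_def transpose_def)
qed

section \<open>Eigenvectors modulo an invariant subspace\<close>

text \<open>The vector \<open>p(A) w\<close> in the Krylov form, with iterates of \<open>A\<close> on \<open>w\<close> in place of matrix powers.\<close>

definition poly_act :: "complex ^ 'n ^ 'n \<Rightarrow> complex poly \<Rightarrow> complex ^ 'n \<Rightarrow> complex ^ 'n"
  where "poly_act A p w = (\<Sum>i\<le>degree p. coeff p i *s (((*v) A) ^^ i) w)"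

lemma poly_act_eq:
  assumes "degree p \<le> m"
  shows "poly_act A p w = (\<Sum>i\<le>m. coeff p i *s (((*v) A) ^^ i) w)"
  unfolding poly_act_def using assms
  by (intro sum.mono_neutral_left) (auto simp: coeff_eq_0)

lemma poly_act_linear_factor:
  "poly_act A ([:- z, 1:] * q) w = A *v poly_act A q w - z *s poly_act A q w"
proof -
  let ?m = "degree q" and ?P = "\<lambda>i. (((*v) A) ^^ i) w"
  have deg: "degree ([:- z, 1:] * q) \<le> Suc ?m"
    using degree_mult_le[of "[:- z, 1:]" q] by simp
  have "poly_act A ([:- z, 1:] * q) w
      = (\<Sum>i\<le>Suc ?m. coeff (pCons 0 q) i *s ?P i) - (\<Sum>i\<le>Suc ?m. (z * coeff q i) *s ?P i)"
    unfolding poly_act_eq[OF deg] sum_subtractf[symmetric] vec.scale_left_diff_distrib[symmetric]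
    by (intro sum.cong) simp_all
  also have "(\<Sum>i\<le>Suc ?m. coeff (pCons 0 q) i *s ?P i) = A *v poly_act A q w"
    unfolding sum.atMost_Suc_shift
    by (simp add: poly_act_def vec.sum vec.scale)
  also have "(\<Sum>i\<le>Suc ?m. (z * coeff q i) *s ?P i) = z *s poly_act A q w"
    unfolding poly_act_eq[of q "Suc ?m", OF le_SucI, OF order_refl] vec.scale_sum_right
    by (simp del: sum.atMost_Suc)
  finally show ?thesis .
qed

text \<open>The \<open>n + 1\<close> vectors \<open>w, A w, \<dots>, A\<^sup>n w\<close> are linearly dependent, or two of them coincide; the latter case
  is separate because dependence is a property of the set of these vectors.\<close>

lemma annihilating_polynomial:
  fixes A :: "complex ^ 'n ^ 'n"
  shows "\<exists>p. p \<noteq> 0 \<and> poly_act A p w = 0"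
proof -
  let ?P = "\<lambda>i. (((*v) A) ^^ i) w"
  show ?thesis
  proof (cases "inj_on ?P {..CARD('n)}")
    case False
    then obtain i j where ij: "i \<noteq> j" "?P i = ?P j"
      by (auto simp: inj_on_def)
    let ?p = "monom 1 i - monom 1 j :: complex poly"
    have "?p \<noteq> 0"
      using ij(1) by (auto simp: poly_eq_iff)
    moreover have deg: "degree ?p \<le> max i j"
      using degree_diff_le_max[of "monom 1 i :: complex poly" "monom 1 j"]
      by (simp add: degree_monom_eq)
    have "poly_act A ?p w = (\<Sum>l\<le>max i j. (if l = i then ?P l else 0) - (if l = j then ?P l else 0))"
      unfolding poly_act_eq[OF deg]
      by (intro sum.cong) auto
    then have "poly_act A ?p w = 0"
      using ij by (simp add: sum_subtractf)
    ultimately show ?thesis by blast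
  next
    case True
    have "vec.dependent (?P ` {..CARD('n)})"
      using dim_subset_UNIV_cart_gen[of "?P ` {..CARD('n)}"] True
      by (intro vec.dependent_biggerset_general) (simp add: card_image)
    then obtain c where c: "\<exists>v\<in>?P ` {..CARD('n)}. c v \<noteq> 0"
        "(\<Sum>v\<in>?P ` {..CARD('n)}. c v *s v) = 0"
      by (auto simp: vec.dependent_finite)
    define p where "p = (\<Sum>i\<le>CARD('n). monom (c (?P i)) i)"
    have co: "coeff p i = (if i \<le> CARD('n) then c (?P i) else 0)" for i
      by (simp add: p_def coeff_sum)
    have "p \<noteq> 0"
      using c(1) co by (metis (no_types, lifting) atMost_iff coeff_0 imageE)
    moreover have deg: "degree p \<le> CARD('n)"
      by (intro degree_le) (simp add: co)
    have "poly_act A p w = 0"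
      unfolding poly_act_eq[OF deg] using c(2) True by (simp add: co sum.reindex)
    ultimately show ?thesis by blast
  qed
qed

text \<open>This is the existence of an eigenvector of the map that \<open>A\<close> induces on the quotient by \<open>V\<close>. Split an
  annihilating polynomial of \<open>w\<close> into linear factors and apply them to \<open>w\<close> one at a time: the last vector
  that is still outside \<open>V\<close> is the desired one.\<close>

lemma eigenvector_modulo_subspace:
  fixes A :: "complex ^ 'n ^ 'n"
  assumes V: "vec.subspace V" and w: "w \<notin> V"
  obtains u z where "u \<notin> V" "A *v u - z *s u \<in> V"
proof -
  have ex: "\<exists>u z. u \<notin> V \<and> A *v u - z *s u \<in> V"
    if "p \<noteq> 0" "poly_act A p w \<in> V" for p
    using that
  proof (induction "degree p" arbitrary: p)
    case 0
    then obtain c where p: "p = [:c:]" "c \<noteq> 0"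
      by (metis degree_0_id pCons_0_0 degree_eq_zeroE)
    then have "c *s w \<in> V"
      using 0 by (simp add: poly_act_def)
    then have "inverse c *s (c *s w) \<in> V"
      by (rule vec.subspace_scale[OF V])
    with p w show ?case by simp
  next
    case (Suc d)
    then obtain z where "poly p z = 0"
      using fundamental_theorem_of_algebra[of p] by (auto simp: constant_degree)
    then obtain q where q: "p = [:- z, 1:] * q"
      by (auto simp: poly_eq_0_iff_dvd)
    with Suc.prems(1) have "q \<noteq> 0" by auto
    then have "degree p = Suc (degree q)"
      unfolding q by (subst degree_mult_eq) auto
    with Suc.hyps(2) have "d = degree q" by simp
    show ?case
    proof (cases "poly_act A q w \<in> V")
      case True
      from Suc.hyps(1)[OF \<open>d = degree q\<close> \<open>q \<noteq> 0\<close> this] show ?thesis .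
    next
      case False
      with Suc.prems(2) show ?thesis
        unfolding q poly_act_linear_factor by blast
    qed
  qed
  obtain p where p: "p \<noteq> 0" "poly_act A p w = 0"
    using annihilating_polynomial by blast
  have "poly_act A p w \<in> V"
    using vec.subspace_0[OF V] p(2) by simp
  from ex[OF p(1) this] that show ?thesis by blast
qed

text \<open>If \<open>A - z\<close> were injective, it would map the finite-dimensional space \<open>V\<close> onto itself; so \<open>(A - z) u\<close>
  would already be the image of an element of \<open>V\<close>, contradicting injectivity.\<close>

lemma eigenvalue_if_eigenvector_modulo_subspace:
  assumes V: "vec.subspace V" and inv: "\<And>v. v \<in> V \<Longrightarrow> A *v v \<in> V"
    and u: "u \<notin> V" "A *v u - z *s u \<in> V"
  shows "eigenvalue A z"
proof (rule ccontr)
  assume ne: "\<not> eigenvalue A z"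
  let ?f = "\<lambda>v. A *v v - z *s v"
  have lin: "Vector_Spaces.linear (*s) (*s) ?f"
    by (rule vec.linear_compose_sub[OF matrix_vector_mul_linear_gen vec.linear_scale_self])
  have ker: "v = 0" if "?f v = 0" for v
    using ne that by (auto simp: eigenvalue_def)
  have inj: "inj ?f"
    using ker by (simp add: vec.linear_inj_iff_eq_0[OF lin])
  have "?f ` V \<subseteq> V"
    using V inv by (auto intro!: vec.subspace_diff vec.subspace_scale)
  moreover have "vec.dim (?f ` V) = vec.dim V"
    by (rule vec.dim_image_eq[OF lin inj_on_subset[OF inj subset_UNIV]])
  ultimately have "?f ` V = V"
    by (intro vec.subspace_dim_equal[OF vec.linear_subspace_image[OF lin V] V]) simp_all
  then have "?f u \<in> ?f ` V"
    using u(2) by simp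
  then obtain v where "v \<in> V" "?f v = ?f u"
    by auto
  with injD[OF inj this(2)] u(1) show False
    by simp
qed

section \<open>Lyapunov's theorem\<close>

locale hermitian_form =
  fixes h :: "complex ^ 'n \<Rightarrow> complex ^ 'n \<Rightarrow> complex"
  assumes add_left: "h (u + v) w = h u w + h v w"
    and scale_left: "h (c *s v) w = c * h v w"
    and hermitian: "h v w = cnj (h w v)"
begin

lemma add_right: "h u (v + w) = h u v + h u w"
  unfolding hermitian[of u] by (simp add: add_left)

lemma scale_right: "h v (c *s w) = cnj c * h v w"
  unfolding hermitian[of v] by (simp add: scale_left)

lemma zero_left: "h 0 w = 0"
  using scale_left[of 0] by simp

lemma zero_right: "h w 0 = 0"
  using scale_right[of w 0] by simp

lemma diff_left: "h (u - v) w = h u w - h v w"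
  using add_left[of "u - v" v w] by simp

text \<open>Besides positivity, the existence of \<open>h\<close>-orthogonal projections onto the subspace is recorded. It would
  follow from positivity, but carrying it along makes it trivial to maintain when one vector is adjoined.\<close>

definition definite_summand :: "(complex ^ 'n) set \<Rightarrow> bool"
  where "definite_summand V \<longleftrightarrow> vec.subspace V \<and> (\<forall>v\<in>V. v \<noteq> 0 \<longrightarrow> Re (h v v) > 0)
    \<and> (\<forall>u. \<exists>v\<in>V. \<forall>w\<in>V. h (u - v) w = 0)"

lemma definite_summand_projection:
  assumes "definite_summand V"
  obtains v where "v \<in> V" "\<And>w. w \<in> V \<Longrightarrow> h (u - v) w = 0"
  using assms unfolding definite_summand_def by meson

lemma definite_summand_extend:
  assumes V: "definite_summand V" and orth: "\<And>v. v \<in> V \<Longrightarrow> h u v = 0"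
    and pos: "Re (h u u) > 0"
  shows "definite_summand {v + c *s u | v c. v \<in> V}" (is "definite_summand ?W")
  unfolding definite_summand_def
proof (intro conjI allI ballI impI)
  have sub: "vec.subspace V" using V by (simp add: definite_summand_def)
  have orth': "h v u = 0" if "v \<in> V" for v
    using orth[OF that] by (subst hermitian) simp
  have "?W = {x + y | x y. x \<in> V \<and> y \<in> vec.span {u}}"
    by (auto simp: vec.span_singleton)
  then show "vec.subspace ?W"
    using vec.subspace_sums[OF sub vec.subspace_span[of "{u}"]] by simp
  fix x assume "x \<in> ?W" "x \<noteq> 0"
  then obtain v c where x: "x = v + c *s u" "v \<in> V" by blast
  have "h x x = h v v + c * cnj c * h u u"
    using orth[OF x(2)] orth'[OF x(2)]
    by (simp add: x(1) add_left add_right scale_left scale_right)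
  then have e: "Re (h x x) = Re (h v v) + (cmod c)\<^sup>2 * Re (h u u)"
    unfolding complex_norm_square[symmetric] by (simp flip: of_real_power)
  have v: "v = 0 \<or> Re (h v v) > 0"
    using V x by (auto simp: definite_summand_def)
  show "Re (h x x) > 0"
  proof (cases "c = 0")
    case True
    with e v x \<open>x \<noteq> 0\<close> show ?thesis by auto
  next
    case False
    then have "(cmod c)\<^sup>2 * Re (h u u) > 0" using pos by simp
    with e v show ?thesis by (auto simp: zero_left)
  qed
next
  have nz: "h u u \<noteq> 0" using pos by auto
  fix x
  obtain v where v: "v \<in> V" "\<And>w. w \<in> V \<Longrightarrow> h (x - v) w = 0"
    using definite_summand_projection[OF V] by metis
  have "h v u = 0" using orth[OF v(1)] by (subst hermitian) simp
  \<comment> \<open>Since \<open>u\<close> is orthogonal to \<open>V\<close>, the projections onto \<open>V\<close> and onto the line of \<open>u\<close> add up.\<close>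
  let ?y = "v + (h x u / h u u) *s u"
  have "h (x - ?y) (w + c *s u) = 0" if "w \<in> V" for w c
    using v(2)[OF that] orth[OF that] \<open>h v u = 0\<close> nz
    by (simp add: diff_left add_left add_right scale_left scale_right)
  then show "\<exists>y\<in>?W. \<forall>w\<in>?W. h (x - y) w = 0"
    using v(1) by (intro bexI[of _ ?y]) auto
qed

text \<open>An \<open>A\<close>-invariant summand of maximal dimension must be the whole space: otherwise an eigenvector modulo
  the summand, made orthogonal to it, could be adjoined.\<close>

lemma lyapunov_positive:
  assumes spec: "\<And>z. eigenvalue A z \<Longrightarrow> Re z > 0"
    and diss: "\<And>v. v \<noteq> 0 \<Longrightarrow> Re (h (A *v v) v) > 0"
    and "v \<noteq> 0"
  shows "Re (h v v) > 0"
proof -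
  define P where "P V \<longleftrightarrow> definite_summand V \<and> (\<forall>v\<in>V. A *v v \<in> V)" for V
  have "P {0}"
    by (auto simp: P_def definite_summand_def zero_right vec.subspace_single_0)
  moreover have "\<forall>V. P V \<longrightarrow> vec.dim V < Suc CARD('n)"
    by (auto intro: le_imp_less_Suc dim_subset_UNIV_cart_gen)
  ultimately obtain V where V: "P V" and max: "\<And>W. P W \<Longrightarrow> vec.dim W \<le> vec.dim V"
    using ex_has_greatest_nat[of P "{0}" vec.dim "Suc CARD('n)"] by blast
  have sub: "vec.subspace V" and inv: "\<And>v. v \<in> V \<Longrightarrow> A *v v \<in> V"
    using V by (auto simp: P_def definite_summand_def)
  have "V = UNIV"
  proof (rule ccontr)
    assume "V \<noteq> UNIV"
    then obtain u0 z where u0: "u0 \<notin> V" "A *v u0 - z *s u0 \<in> V"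
      using eigenvector_modulo_subspace[OF sub] by blast
    have z: "Re z > 0"
      using eigenvalue_if_eigenvector_modulo_subspace[OF sub inv u0] spec by blast
    obtain v0 where v0: "v0 \<in> V" "\<And>w. w \<in> V \<Longrightarrow> h (u0 - v0) w = 0"
      using V definite_summand_projection unfolding P_def by metis
    define u where "u = u0 - v0"
    have "u \<notin> V"
      using u0(1) v0(1) sub by (metis u_def diff_add_cancel vec.subspace_add)
    have "A *v u - z *s u = (A *v u0 - z *s u0) - (A *v v0 - z *s v0)"
      by (simp add: u_def vec.diff vec.scale_right_diff_distrib)
    also have "\<dots> \<in> V"
      by (rule vec.subspace_diff[OF sub u0(2) vec.subspace_diff[OF sub
            inv[OF v0(1)] vec.subspace_scale[OF sub v0(1)]]])
    finally obtain y where y: "y \<in> V" "A *v u = y + z *s u"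
      by (metis diff_add_cancel)
    have orth: "h u v = 0" if "v \<in> V" for v
      using v0 that by (simp add: u_def)
    then have "h y u = 0"
      using y by (subst hermitian) simp
    then have "h (A *v u) u = z * h u u"
      by (simp add: y add_left scale_left)
    moreover have "Im (h u u) = 0"
      using hermitian[of u u] by (simp add: complex_eq_iff)
    ultimately have "Re z * Re (h u u) > 0"
      using diss[of u] \<open>u \<notin> V\<close> vec.subspace_0[OF sub] by force
    with z have "Re (h u u) > 0"
      by (simp add: zero_less_mult_iff)
    let ?W = "{v + c *s u | v c. v \<in> V}"
    have "definite_summand ?W"
      using V orth \<open>Re (h u u) > 0\<close> by (intro definite_summand_extend) (auto simp: P_def)
    moreover have "A *v (v + c *s u) \<in> ?W" if "v \<in> V" for v c
    proof -
      have "A *v (v + c *s u) = (A *v v + c *s y) + (c * z) *s u"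
        by (simp add: vec.add vec.scale y vec.scale_right_distrib)
      moreover have "A *v v + c *s y \<in> V"
        using that y inv sub by (intro vec.subspace_add vec.subspace_scale) auto
      ultimately show ?thesis by blast
    qed
    ultimately have "P ?W"
      by (auto simp: P_def)
    moreover have "V \<subseteq> ?W"
      by (force intro: exI[of _ 0])
    moreover have "u \<in> ?W"
      using vec.subspace_0[OF sub] by (force intro: exI[of _ 1])
    moreover have "vec.subspace ?W"
      using \<open>definite_summand ?W\<close> by (simp add: definite_summand_def)
    ultimately show False
      using max[of ?W] vec.subspace_dim_equal[OF sub, of ?W] \<open>u \<notin> V\<close> by blast
  qed
  with V \<open>v \<noteq> 0\<close> show ?thesis
    by (auto simp: P_def definite_summand_def)
qed

end

text \<open>The solution \<open>G\<close> is not known to be Hermitian in advance, so the result on Hermitian forms cannot be applied to it directly. It is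
  applied to the Hermitian parts of \<open>z G\<close> for all \<open>z\<close> with real part \<open>1\<close>; they all satisfy the same Lyapunov
  equation, as \<open>C\<close> is Hermitian. Positivity for all these \<open>z\<close> leaves no room for an imaginary part of
  \<open>v\<^sup>* G v\<close>.\<close>

theorem lyapunov_solution_posdef:
  assumes spec: "\<And>z. eigenvalue A z \<Longrightarrow> Re z > 0"
    and C: "hermitian_posdef C"
    and eq: "conj_transpose A ** G + G ** A = C"
  shows "hermitian_posdef G"
proof -
  have lyap: "ginner G v (A *v w) + ginner G (A *v v) w = ginner C v w" for v w
    unfolding eq[symmetric] ginner_matrix_add ginner_adjoint ginner_mult[of G A] ..
  have Cim: "Im (ginner C v v) = 0" for v
    using ginner_self_real[OF C, of v] by (simp add: complex_eq_iff)
  have pos: "Re (ginner G v v) - s * Im (ginner G v v) > 0" if "v \<noteq> 0" for s v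
  proof -
    let ?z = "Complex 1 s"
    \<comment> \<open>Twice the Hermitian part of \<open>?z\<close> times the form of \<open>G\<close>.\<close>
    let ?h = "\<lambda>v w. ?z * ginner G v w + cnj (?z * ginner G w v)"
    interpret hermitian_form ?h
      by unfold_locales
        (simp_all add: ginner_add_left ginner_add_right ginner_scale_left ginner_scale_right
          algebra_simps)
    have "Re (?h (A *v v) v) > 0" if "v \<noteq> 0" for v
    proof -
      have "Re (?h (A *v v) v) = Re (?z * (ginner G v (A *v v) + ginner G (A *v v) v))"
        by (simp add: algebra_simps)
      also have "\<dots> = Re (ginner C v v)"
        unfolding lyap by (simp add: Cim)
      finally show ?thesis
        using C that by (simp add: hermitian_posdef_def)
    qed
    from lyapunov_positive[OF spec this \<open>v \<noteq> 0\<close>] show ?thesis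
      by simp
  qed
  have im: "Im (ginner G v v) = 0" for v
  proof (cases "v = 0")
    case False
    show ?thesis
    proof (rule ccontr)
      assume "Im (ginner G v v) \<noteq> 0"
      then show False
        using pos[OF False, of "Re (ginner G v v) / Im (ginner G v v)"] by simp
    qed
  qed (simp add: ginner_def)
  show ?thesis
    unfolding hermitian_posdef_def
    using hermitian_if_real_quadratic_form[OF im] pos[of _ 0] by simp
qed

section \<open>Comparison of the two norms\<close>

lemma ginner_identity_le: "cmod (ginner (mat 1) v w) \<le> norm v * norm w"
proof -
  have "cmod (ginner (mat 1) v w) \<le> (\<Sum>i\<in>UNIV. \<bar>cmod (v $ i)\<bar> * \<bar>cmod (w $ i)\<bar>)"
    unfolding ginner_def by (intro sum_norm_le) (simp add: norm_mult mult.commute)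
  also have "\<dots> \<le> norm v * norm w"
    unfolding norm_vec_def by (rule L2_set_mult_ineq)
  finally show ?thesis .
qed

lemma ginner_identity_self: "ginner (mat 1) v v = of_real ((norm v)\<^sup>2)"
  by (simp add: ginner_def norm_vec_def L2_set_def sum_nonneg complex_norm_square mult.commute
      del: of_real_power)

lemma ginner_via_identity: "ginner G v w = ginner (mat 1) (G *v v) w"
  by (simp add: ginner_def)

lemma bounded_linear_matrix_vector_mult: "bounded_linear ((*v) (X :: complex ^ 'n ^ 'm))"
  by (intro linear_conv_bounded_linear[THEN iffD1] linearI)
    (simp_all add: matrix_vector_right_distrib matrix_vector_mult_scaleR_complex)

lemma norm_matrix_vector_le: "norm (X *v v) \<le> matrix_norm2 X * norm v"
  unfolding matrix_norm2_def by (rule onorm[OF bounded_linear_matrix_vector_mult])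

lemma matrix_norm2_nonneg: "matrix_norm2 X \<ge> 0"
  unfolding matrix_norm2_def by (rule onorm_pos_le[OF bounded_linear_matrix_vector_mult])

lemma ginner_le_norm: "Re (ginner G v v) \<le> matrix_norm2 G * (norm v)\<^sup>2"
proof -
  have "Re (ginner G v v) \<le> norm (G *v v) * norm v"
    using ginner_identity_le[of "G *v v" v] complex_Re_le_cmod[of "ginner G v v"]
    unfolding ginner_via_identity[of G] by linarith
  also have "\<dots> \<le> matrix_norm2 G * norm v * norm v"
    by (intro mult_right_mono norm_matrix_vector_le) simp
  finally show ?thesis by (simp add: power2_eq_square mult.assoc)
qed

lemma ginner_self_nonneg:
  assumes "hermitian_posdef G"
  shows "Re (ginner G v v) \<ge> 0"
  using assms by (cases "v = 0") (auto simp: hermitian_posdef_def ginner_def order.strict_iff_order)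

lemma ginner_diff_scaled:
  assumes "hermitian_posdef G"
  shows "Re (ginner G (v - of_real t *s w) (v - of_real t *s w))
    = Re (ginner G v v) - 2 * t * Re (ginner G w v) + t\<^sup>2 * Re (ginner G w w)"
proof -
  have e: "v - of_real t *s w = v + of_real (- t) *s w"
    by (simp add: vec_eq_iff)
  have "ginner G v w = cnj (ginner G w v)"
    using assms by (intro ginner_hermitian) (simp add: hermitian_posdef_def)
  then show ?thesis
    unfolding e ginner_add_left ginner_add_right ginner_scale_left ginner_scale_right
    by (simp add: power2_eq_square algebra_simps)
qed

lemma posdef_invertible:
  assumes "hermitian_posdef G"
  shows "G ** matrix_inv G = mat 1"
proof -
  have "v = 0" if "G *v v = 0" for v
    using assms that by (force simp: hermitian_posdef_def ginner_def)
  then have "invertible G"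
    by (auto simp: invertible_left_inverse matrix_left_invertible_ker)
  then show ?thesis
    by (auto simp: invertible_def matrix_inv_def intro: someI2_ex)
qed

text \<open>Put \<open>w = G\<^sup>-\<^sup>1 v\<close>. Then \<open>\<langle>w, v\<rangle>\<^sub>G = \<parallel>v\<parallel>\<^sup>2\<close> in the Euclidean norm, while \<open>\<langle>w, w\<rangle>\<^sub>G = v\<^sup>* w \<le> N \<parallel>v\<parallel>\<^sup>2\<close> with
  \<open>N = \<parallel>G\<^sup>-\<^sup>1\<parallel>\<close>; the claim follows as in the Cauchy-Schwarz inequality from \<open>0 \<le> \<langle>v - t w, v - t w\<rangle>\<^sub>G\<close>. The value
  \<open>t = 1 / N\<close> makes the resulting lower bound for \<open>v\<^sup>* G v\<close> largest.\<close>

lemma norm_le_ginner: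
  assumes G: "hermitian_posdef G"
  shows "(norm v)\<^sup>2 \<le> matrix_norm2 (matrix_inv G) * Re (ginner G v v)"
proof (cases "v = 0")
  case False
  define N w where "N = matrix_norm2 (matrix_inv G)" and "w = matrix_inv G *v v"
  have Gw: "G *v w = v"
    by (simp add: w_def matrix_vector_mul_assoc posdef_invertible[OF G])
  have w: "norm w \<le> N * norm v"
    unfolding N_def w_def by (rule norm_matrix_vector_le)
  have "w \<noteq> 0"
    using Gw False by auto
  then have "0 < N * norm v"
    using w by (intro less_le_trans[OF _ w]) simp
  then have N: "N > 0"
    using False by (simp add: zero_less_mult_iff)
  have 1: "Re (ginner G w v) = (norm v)\<^sup>2"
    using ginner_identity_self[of v] by (simp add: ginner_via_identity[of G] Gw del: of_real_power)
  have "Re (ginner G w w) \<le> norm v * norm w"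
    using ginner_identity_le[of v w] complex_Re_le_cmod[of "ginner G w w"]
    unfolding ginner_via_identity[of G] Gw by linarith
  also have "\<dots> \<le> N * (norm v)\<^sup>2"
    using mult_left_mono[OF w, of "norm v"] by (simp add: power2_eq_square mult_ac)
  finally have 2: "Re (ginner G w w) \<le> N * (norm v)\<^sup>2" .
  have "0 \<le> Re (ginner G v v) - 2 * (1 / N) * (norm v)\<^sup>2 + (1 / N)\<^sup>2 * Re (ginner G w w)"
    using ginner_self_nonneg[OF G, of "v - of_real (1 / N) *s w"]
    unfolding ginner_diff_scaled[OF G] 1 .
  also have "(1 / N)\<^sup>2 * Re (ginner G w w) \<le> (1 / N)\<^sup>2 * (N * (norm v)\<^sup>2)"
    using 2 by (intro mult_left_mono) auto
  also have "\<dots> = (norm v)\<^sup>2 / N"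
    using N by (simp add: power2_eq_square)
  finally show ?thesis
    using N unfolding N_def[symmetric] by (simp add: field_simps)
qed (simp add: ginner_def)

section \<open>Contraction of the damped residual\<close>

text \<open>By the Lyapunov equation, \<open>2 Re \<langle>A v, v\<rangle>\<^sub>G = v\<^sup>* C v > 0\<close>, and the infimum defining \<open>\<mu>\<close> is attained.\<close>

lemma mu_pos:
  assumes G: "hermitian_posdef G" and C: "hermitian_posdef C"
    and eq: "conj_transpose A ** G + G ** A = C"
  shows "mu G A > 0"
proof -
  obtain v where v: "v \<noteq> 0" "mu G A = Re (ginner G (A *v v) v / ginner G v v)"
    using mu_attained(1)[OF G, of A] by (auto simp: numerical_range_def)
  have herm: "conj_transpose G = G" using G by (simp add: hermitian_posdef_def)
  have "ginner C v v = ginner G v (A *v v) + ginner G (A *v v) v"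
    unfolding eq[symmetric] ginner_matrix_add ginner_adjoint ginner_mult[of G A] ..
  then have "2 * Re (ginner G (A *v v) v) = Re (ginner C v v)"
    using ginner_hermitian[OF herm, of v "A *v v"] by simp
  moreover have "Re (ginner C v v) > 0" "Re (ginner G v v) > 0"
    using C G v(1) by (auto simp: hermitian_posdef_def)
  ultimately show ?thesis
    unfolding v(2) by (subst ginner_self_real[OF G]) (simp add: Re_divide_of_real)
qed

lemma mu_le_ginner:
  assumes G: "hermitian_posdef G"
  shows "mu G A * Re (ginner G v v) \<le> Re (ginner G (A *v v) v)"
proof (cases "v = 0")
  case False
  have pos: "Re (ginner G v v) > 0"
    using G False by (auto simp: hermitian_posdef_def)
  have "mu G A \<le> Re (ginner G (A *v v) v / ginner G v v)"
    using False by (intro mu_attained(2)[OF G]) (auto simp: numerical_range_def)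
  also have "\<dots> = Re (ginner G (A *v v) v) / Re (ginner G v v)"
    by (subst ginner_self_real[OF G]) (simp add: Re_divide_of_real)
  finally show ?thesis
    using pos by (simp add: field_simps)
qed (simp add: ginner_def)

lemma gnorm_mult_le:
  assumes G: "hermitian_posdef G"
  shows "gnorm G (X *v v) \<le> matrix_gnorm G X * gnorm G v"
proof (cases "v = 0")
  case False
  then have "gnorm G v > 0"
    using G by (auto simp: hermitian_posdef_def gnorm_def)
  with matrix_gnorm_attained(2)[OF G False, of X] show ?thesis
    by (simp add: field_simps)
qed (simp add: gnorm_def ginner_def)

lemma gnorm_sq:
  assumes "hermitian_posdef G"
  shows "(gnorm G v)\<^sup>2 = Re (ginner G v v)"
  using ginner_self_nonneg[OF assms] by (simp add: gnorm_def)

text \<open>The parameter \<open>\<alpha>\<close> minimises the bound \<open>1 - 2 \<alpha> \<mu> + \<alpha>\<^sup>2 \<parallel>A\<parallel>\<^sup>2\<close> on the squared contraction factor. Positivity of \<open>\<mu>\<close>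
  enters through \<open>\<alpha> \<ge> 0\<close>, without which the bound on \<open>Re \<langle>A v, v\<rangle>\<close> could not be used.\<close>

lemma damped_step_contraction:
  assumes G: "hermitian_posdef G" and mu: "mu G A > 0"
  defines "\<alpha> \<equiv> mu G A / (matrix_gnorm G A)\<^sup>2"
  shows "gnorm G (v - of_real \<alpha> *s (A *v v))
    \<le> sqrt (1 - (mu G A)\<^sup>2 / (matrix_gnorm G A)\<^sup>2) * gnorm G v"
proof -
  define m M g where "m = mu G A" and "M = matrix_gnorm G A" and "g = Re (ginner G v v)"
  have "\<alpha> \<ge> 0"
    using mu by (simp add: \<alpha>_def)
  have "Re (ginner G (A *v v) (A *v v)) \<le> M\<^sup>2 * g"
    using power_mono[OF gnorm_mult_le[OF G, of A v], of 2] ginner_self_nonneg[OF G]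
    unfolding M_def g_def by (simp add: power_mult_distrib gnorm_sq[OF G] gnorm_def)
  then have "\<alpha>\<^sup>2 * Re (ginner G (A *v v) (A *v v)) \<le> \<alpha>\<^sup>2 * (M\<^sup>2 * g)"
    by (intro mult_left_mono) auto
  moreover have "2 * \<alpha> * (m * g) \<le> 2 * \<alpha> * Re (ginner G (A *v v) v)"
    using mu_le_ginner[OF G, of A v] \<open>\<alpha> \<ge> 0\<close> unfolding m_def g_def by (intro mult_left_mono) auto
  moreover have "(gnorm G (v - of_real \<alpha> *s (A *v v)))\<^sup>2
      = g - 2 * \<alpha> * Re (ginner G (A *v v) v) + \<alpha>\<^sup>2 * Re (ginner G (A *v v) (A *v v))"
    unfolding gnorm_sq[OF G] ginner_diff_scaled[OF G] g_def ..
  ultimately have "(gnorm G (v - of_real \<alpha> *s (A *v v)))\<^sup>2 \<le> g - 2 * \<alpha> * (m * g) + \<alpha>\<^sup>2 * (M\<^sup>2 * g)"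
    by linarith
  also have "\<dots> = (1 - m\<^sup>2 / M\<^sup>2) * g"
    unfolding \<alpha>_def m_def[symmetric] M_def[symmetric]
    by (cases "M = 0") (simp_all add: field_simps power2_eq_square)
  finally have "sqrt ((gnorm G (v - of_real \<alpha> *s (A *v v)))\<^sup>2) \<le> sqrt ((1 - m\<^sup>2 / M\<^sup>2) * g)"
    by (rule real_sqrt_le_mono)
  moreover have "gnorm G w \<ge> 0" for w
    using ginner_self_nonneg[OF G] by (simp add: gnorm_def)
  ultimately show ?thesis
    by (simp add: real_sqrt_mult g_def m_def M_def flip: gnorm_def)
qed

section \<open>Residuals reachable from the Krylov space\<close>

lemma krylov_mono: "i \<le> k \<Longrightarrow> krylov A b i \<subseteq> krylov A b k"
  unfolding krylov_def by (intro vec.span_mono image_mono) auto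

lemma krylov_mult:
  assumes "y \<in> krylov A b k"
  shows "A *v y \<in> krylov A b (Suc k)"
proof -
  have "A *v y \<in> (*v) A ` krylov A b k"
    using assms by blast
  also have "\<dots> = vec.span ((*v) A ` (\<lambda>j. (((*v) A) ^^ j) b) ` {..<k})"
    unfolding krylov_def by (rule vec.linear_span_image[OF matrix_vector_mul_linear_gen, symmetric])
  also have "\<dots> \<subseteq> krylov A b (Suc k)"
    unfolding krylov_def
    by (intro vec.span_mono) (force intro: image_eqI[where x = "Suc _"])
  finally show ?thesis .
qed

text \<open>The witnesses are the Richardson iterates \<open>y\<^sub>k\<^sub>+\<^sub>1 = y\<^sub>k + c (b - A y\<^sub>k)\<close> with \<open>y\<^sub>0 = 0\<close>.\<close>

lemma damped_residual_in_krylov: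
  "\<exists>y\<in>krylov A b k. b - A *v y = ((\<lambda>v. v - c *s (A *v v)) ^^ k) b"
proof (induction k)
  case 0
  show ?case by (intro bexI[of _ 0]) (auto simp: krylov_def vec.span_zero)
next
  case (Suc k)
  then obtain y where y: "y \<in> krylov A b k" "b - A *v y = ((\<lambda>v. v - c *s (A *v v)) ^^ k) b"
    by blast
  have "y \<in> krylov A b (Suc k)"
    using y(1) krylov_mono[of k "Suc k" A b] by auto
  moreover have "b \<in> krylov A b (Suc k)"
    unfolding krylov_def by (intro vec.span_base image_eqI[of _ _ 0]) auto
  ultimately have "y + c *s (b - A *v y) \<in> krylov A b (Suc k)"
    using krylov_mult[OF y(1)] unfolding krylov_def
    by (intro vec.span_add vec.span_scale vec.span_diff)
  moreover have "b - A *v (y + c *s (b - A *v y)) = ((\<lambda>v. v - c *s (A *v v)) ^^ Suc k) b"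
    by (simp add: y(2)[symmetric] vec.add vec.scale algebra_simps)
  ultimately show ?case by blast
qed

section \<open>The residual bound for GMRES\<close>

text \<open>In the final chain, optimality of the iterate replaces \<open>r\<close> by the damped residual; the factor \<open>\<rho>\<^sup>k\<close> is gained
  in the \<open>G\<close>-norm, between the two norm comparisons.\<close>

theorem corollary1:
  fixes A C G :: "complex ^ 'n ^ 'n" and b x r :: "complex ^ 'n" and k :: nat
  assumes "\<And>z. eigenvalue A z \<Longrightarrow> Re z > 0"
    and "hermitian_posdef C"
    and "conj_transpose A ** G + G ** A = C"
    and "b \<noteq> 0"
    and "gmres_iterate A b k x"
    and "r = b - A *v x"
  shows "norm r / norm b
    \<le> sqrt (cond2 G) * sqrt (1 - (mu G A)\<^sup>2 / (matrix_gnorm G A)\<^sup>2) ^ k"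
proof -
  define \<rho> where "\<rho> = sqrt (1 - (mu G A)\<^sup>2 / (matrix_gnorm G A)\<^sup>2)"
  define \<alpha> where "\<alpha> = mu G A / (matrix_gnorm G A)\<^sup>2"
  define T where "T = (\<lambda>v. v - of_real \<alpha> *s (A *v v))"
  have G: "hermitian_posdef G"
    using assms(1-3) by (rule lyapunov_solution_posdef)
  have step: "gnorm G (T v) \<le> \<rho> * gnorm G v" for v
    using damped_step_contraction[OF G mu_pos[OF G assms(2,3)], of v]
    by (simp add: T_def \<rho>_def \<alpha>_def)
  have nonneg: "gnorm G v \<ge> 0" for v
    using ginner_self_nonneg[OF G] by (simp add: gnorm_def)
  \<comment> \<open>The root \<open>\<rho>\<close> would be negative for a negative radicand; the contraction estimate itself excludes this.\<close>
  have "gnorm G b > 0"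
    using G \<open>b \<noteq> 0\<close> by (simp add: hermitian_posdef_def gnorm_def)
  moreover have "0 \<le> \<rho> * gnorm G b"
    using step[of b] nonneg[of "T b"] by linarith
  ultimately have "\<rho> \<ge> 0"
    by (simp add: zero_le_mult_iff)
  have iter: "gnorm G ((T ^^ k) b) \<le> \<rho> ^ k * gnorm G b"
  proof (induction k)
    case (Suc k)
    have "gnorm G ((T ^^ Suc k) b) \<le> \<rho> * gnorm G ((T ^^ k) b)"
      using step by simp
    also have "\<dots> \<le> \<rho> * (\<rho> ^ k * gnorm G b)"
      using Suc \<open>\<rho> \<ge> 0\<close> by (rule mult_left_mono)
    finally show ?case by (simp add: mult.assoc)
  qed simp
  let ?N = "matrix_norm2 (matrix_inv G)"
  obtain y where y: "y \<in> krylov A b k" "b - A *v y = (T ^^ k) b"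
    using damped_residual_in_krylov[of A b k "of_real \<alpha>"] unfolding T_def by blast
  have "norm r \<le> norm ((T ^^ k) b)"
    using assms(5) y unfolding gmres_iterate_def is_arg_min_linorder assms(6) by metis
  also have "\<dots> \<le> sqrt ?N * gnorm G ((T ^^ k) b)"
    using real_sqrt_le_mono[OF norm_le_ginner[OF G, of "(T ^^ k) b"]]
    by (simp add: real_sqrt_mult gnorm_def)
  also have "\<dots> \<le> sqrt ?N * (\<rho> ^ k * gnorm G b)"
    using iter matrix_norm2_nonneg[of "matrix_inv G"] by (intro mult_left_mono) auto
  also have "\<dots> \<le> sqrt ?N * (\<rho> ^ k * (sqrt (matrix_norm2 G) * norm b))"
  proof -
    have "gnorm G b \<le> sqrt (matrix_norm2 G) * norm b"
      using real_sqrt_le_mono[OF ginner_le_norm[of G b]]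
      by (simp add: real_sqrt_mult gnorm_def)
    then show ?thesis
      using \<open>\<rho> \<ge> 0\<close> matrix_norm2_nonneg[of "matrix_inv G"]
      by (intro mult_left_mono) auto
  qed
  also have "\<dots> = sqrt (cond2 G) * \<rho> ^ k * norm b"
    by (simp add: cond2_def real_sqrt_mult)
  finally show ?thesis
    using \<open>b \<noteq> 0\<close> by (simp add: \<rho>_def divide_le_eq)
qed

end
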